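(* For every block $\Pi$: $\Pi$ is refutable in $\mathsf{BT}^{i}$ if and only if the sequent $\Gamma_\Pi\Rightarrow\Delta_\Pi$ is derivable in $\mathsf{G3T}^{i}$. Equivalently, for all finite multisets $\Gamma,\Delta$ of formulae, the sequent $\Gamma\Rightarrow\Delta$ is derivable in $\mathsf{G3T}^{i}$ if and only if the block $\mathsf{T}[\Gamma]\cup\mathsf{F}[\Delta]$ is refutable in $\mathsf{BT}^{i}$.
   Context: Formulae are generated from a countable set of propositional variables by $A ::= p \mid \bot \mid A\land A \mid A\lor A \mid A\to A$. Blocks. A signed formula is $\mathsf{T}A$ or $\mathsf{F}A$; a block is a finite set $\Pi$ of signed formulae. $\Pi^{\mathsf{T}}=\{\mathsf{T}A:\mathsf{T}A\in\Pi\}$. For a multiset $\Gamma$, $\mathsf{T}[\Gamma]=\{\mathsf{T}A:A\in\Gamma\}$ and $\mathsf{F}[\Gamma]=\{\mathsf{F}A:A\in\Gamma\}$. For a block $\Pi$, $\Gamma_\Pi=\{A:\mathsf{T}A\in\Pi\}$ and $\Delta_\Pi=\{A:\mathsf{F}A\in\Pi\}$, read as multisets in which every formula occurs once. The calculus $\mathsf{BT}^{i}$. A block is closed if it contains $\mathsf{T}p$ and $\mathsf{F}p$ for some propositional variable $p$, or contains $\mathsf{T}\bot$. The rules pass from a block (context $\Pi$ plus displayed principal formula, which is removed unless displayed again) to one or two children: - $\mathsf{T}\land$: from $\Pi,\mathsf{T}(A\land B)$ to $\Pi,\mathsf{T}A,\mathsf{T}B$. - $\mathsf{F}\lor$: from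 $\Pi,\mathsf{F}(A\lor B)$ to $\Pi,\mathsf{F}A,\mathsf{F}B$. - $\mathsf{T}\lor$: from $\Pi,\mathsf{T}(A\lor B)$ to two children $\Pi,\mathsf{T}A$ and $\Pi,\mathsf{T}B$. - $\mathsf{F}\land$: from $\Pi,\mathsf{F}(A\land B)$ to two children $\Pi,\mathsf{F}A$ and $\Pi,\mathsf{F}B$. - $\mathsf{T}\to$: from $\Pi,\mathsf{T}(A\to B)$ to two children $\Pi,\mathsf{T}(A\to B),\mathsf{F}A$ and $\Pi,\mathsf{T}B$. - $\mathsf{F}\to$: from $\Pi,\mathsf{F}(A\to B)$ to $\Pi^{\mathsf{T}},\mathsf{T}A,\mathsf{F}B$. A tableau for $\Pi$ is a finite tree rooted at $\Pi$ grown by these rules; it is closed if every leaf is a closed block. $\Pi$ is refutable if it has a closed tableau. The calculus $\mathsf{G3T}^{i}$. Sequents $\Gamma\Rightarrow\Delta$ have $\Gamma,\Delta$ finite multisets of formulae. Initial sequents: $p,\Gamma\Rightarrow\Delta,p$ ($p$ a variable) and $\bot,\Gamma\Rightarrow\Delta$. Rules (premisses / conclusion): - $\land\mathrm L$: $A,B,\Gamma\Rightarrow\Delta$ / $A\land B,\Gamma\Rightarrow\Delta$. - $\lor\mathrm L$: $A,\Gamma\Rightarrow\Delta$ and $B,\Gamma\Rightarrow\Delta$ / $A\lor B,\Gamma\Rightarrow\Delta$. - $\to\!\mathrm L$: $A\to B,\Gamma\Rightarrow\Delta,A$ and $B,\Gamma\Rightarrow\Delta$ / $A\to B,\Gamma\Rightarrow\Delta$.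 - $\land\mathrm R$: $\Gamma\Rightarrow\Delta,A$ and $\Gamma\Rightarrow\Delta,B$ / $\Gamma\Rightarrow\Delta,A\land B$. - $\lor\mathrm R$: $\Gamma\Rightarrow\Delta,A,B$ / $\Gamma\Rightarrow\Delta,A\lor B$. - $\to\!\mathrm R$: $A,\Gamma\Rightarrow B$ / $\Gamma\Rightarrow\Delta,A\to B$. *)

theory Defs
  imports Main "HOL-Library.Multiset" "HOL-Library.Countable"
begin

datatype 'v form =
    Var 'v
  | Bot  ("\<^bold>\<bottom>")
  | And "'v form" "'v form"  (infixr "\<^bold>\<and>" 75)
  | Or "'v form" "'v form"  (infixr "\<^bold>\<or>" 74)
  | Imp "'v form" "'v form"  (infixr "\<^bold>\<rightarrow>" 73)

datatype 'v sform = T "'v form" | F "'v form"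

text \<open>Blocks are the finite sets of this type; finiteness is assumed where it matters.\<close>

type_synonym 'v block = "'v sform set"

definition T_part :: "'v block \<Rightarrow> 'v block" where
  "T_part \<Pi> = {X \<in> \<Pi>. \<exists>A. X = T A}"

definition block_of :: "'v form multiset \<Rightarrow> 'v form multiset \<Rightarrow> 'v block" where
  "block_of \<Gamma> \<Delta> = T ` set_mset \<Gamma> \<union> F ` set_mset \<Delta>"

definition ant :: "'v block \<Rightarrow> 'v form multiset" where
  "ant \<Pi> = mset_set {A. T A \<in> \<Pi>}"

definition suc :: "'v block \<Rightarrow> 'v form multiset" where
  "suc \<Pi> = mset_set {A. F A \<in> \<Pi>}"

definition closed_block :: "'v block \<Rightarrow> bool" where
  "closed_block \<Pi> \<longleftrightarrow> (\<exists>p. T (Var p) \<in> \<Pi> \<and> F (Var p) \<in> \<Pi>) \<or> T \<^bold>\<bottom> \<in> \<Pi>"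

text \<open>
  \<open>bt_rule \<Pi> \<Pi>s\<close>: the block \<open>\<Pi>\<close> may be expanded to the list \<open>\<Pi>s\<close> of its children.
  Since blocks are sets, the side conditions make sure that the principal formula does not
  survive in the context, i.e. that it is really removed unless it is displayed again.
\<close>

inductive bt_rule :: "'v block \<Rightarrow> 'v block list \<Rightarrow> bool" where
  T_And: "T (A \<^bold>\<and> B) \<notin> \<Pi> \<Longrightarrow>
    bt_rule (insert (T (A \<^bold>\<and> B)) \<Pi>) [\<Pi> \<union> {T A, T B}]"
| F_Or: "F (A \<^bold>\<or> B) \<notin> \<Pi> \<Longrightarrow>
    bt_rule (insert (F (A \<^bold>\<or> B)) \<Pi>) [\<Pi> \<union> {F A, F B}]"
| T_Or: "T (A \<^bold>\<or> B) \<notin> \<Pi> \<Longrightarrow>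
    bt_rule (insert (T (A \<^bold>\<or> B)) \<Pi>) [\<Pi> \<union> {T A}, \<Pi> \<union> {T B}]"
| F_And: "F (A \<^bold>\<and> B) \<notin> \<Pi> \<Longrightarrow>
    bt_rule (insert (F (A \<^bold>\<and> B)) \<Pi>) [\<Pi> \<union> {F A}, \<Pi> \<union> {F B}]"
| T_Imp: "T (A \<^bold>\<rightarrow> B) \<notin> \<Pi> \<Longrightarrow>
    bt_rule (insert (T (A \<^bold>\<rightarrow> B)) \<Pi>) [\<Pi> \<union> {T (A \<^bold>\<rightarrow> B), F A}, \<Pi> \<union> {T B}]"
| F_Imp: "F (A \<^bold>\<rightarrow> B) \<notin> \<Pi> \<Longrightarrow>
    bt_rule (insert (F (A \<^bold>\<rightarrow> B)) \<Pi>) [T_part \<Pi> \<union> {T A, F B}]"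

datatype 'v btree = Node (root: "'v block") (children: "'v btree list")

inductive tableau :: "'v btree \<Rightarrow> bool" where
  leaf: "tableau (Node \<Pi> [])"
| expand: "bt_rule \<Pi> (map root ts) \<Longrightarrow> (\<And>t. t \<in> set ts \<Longrightarrow> tableau t) \<Longrightarrow> tableau (Node \<Pi> ts)"

fun leaves :: "'v btree \<Rightarrow> 'v block set" where
  "leaves (Node \<Pi> ts) = (if ts = [] then {\<Pi>} else (\<Union>t \<in> set ts. leaves t))"

definition refutable :: "'v block \<Rightarrow> bool" where
  "refutable \<Pi> \<longleftrightarrow> (\<exists>t. tableau t \<and> root t = \<Pi> \<and> (\<forall>\<Pi>' \<in> leaves t. closed_block \<Pi>'))"

inductive G3Ti :: "'v form multiset \<Rightarrow> 'v form multiset \<Rightarrow> bool"  (infix "\<Rightarrow>\<^sub>G" 50) where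
  Ax: "add_mset (Var p) \<Gamma> \<Rightarrow>\<^sub>G add_mset (Var p) \<Delta>"
| BotL: "add_mset \<^bold>\<bottom> \<Gamma> \<Rightarrow>\<^sub>G \<Delta>"
| AndL: "add_mset A (add_mset B \<Gamma>) \<Rightarrow>\<^sub>G \<Delta> \<Longrightarrow> add_mset (A \<^bold>\<and> B) \<Gamma> \<Rightarrow>\<^sub>G \<Delta>"
| OrL: "add_mset A \<Gamma> \<Rightarrow>\<^sub>G \<Delta> \<Longrightarrow> add_mset B \<Gamma> \<Rightarrow>\<^sub>G \<Delta> \<Longrightarrow> add_mset (A \<^bold>\<or> B) \<Gamma> \<Rightarrow>\<^sub>G \<Delta>"
| ImpL: "add_mset (A \<^bold>\<rightarrow> B) \<Gamma> \<Rightarrow>\<^sub>G add_mset A \<Delta> \<Longrightarrow> add_mset B \<Gamma> \<Rightarrow>\<^sub>G \<Delta> \<Longrightarrow>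
    add_mset (A \<^bold>\<rightarrow> B) \<Gamma> \<Rightarrow>\<^sub>G \<Delta>"
| AndR: "\<Gamma> \<Rightarrow>\<^sub>G add_mset A \<Delta> \<Longrightarrow> \<Gamma> \<Rightarrow>\<^sub>G add_mset B \<Delta> \<Longrightarrow> \<Gamma> \<Rightarrow>\<^sub>G add_mset (A \<^bold>\<and> B) \<Delta>"
| OrR: "\<Gamma> \<Rightarrow>\<^sub>G add_mset A (add_mset B \<Delta>) \<Longrightarrow> \<Gamma> \<Rightarrow>\<^sub>G add_mset (A \<^bold>\<or> B) \<Delta>"
| ImpR: "add_mset A \<Gamma> \<Rightarrow>\<^sub>G {#B#} \<Longrightarrow> \<Gamma> \<Rightarrow>\<^sub>G add_mset (A \<^bold>\<rightarrow> B) \<Delta>"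

end

theory Submission imports Defs begin

text \<open>
  The two calculi have the same rules; what separates them is contraction. In a multiset the
  principal formula of a rule may have further copies in the context, and these survive the rule,
  whereas a tableau rule removes the signed formula from the block altogether.

  From tableaux to sequents this does no harm, provided the claim is stated with a built-in
  weakening: if \<open>\<Pi>\<close> is refutable, then every sequent whose block \<^emph>\<open>contains\<close> \<open>\<Pi>\<close> is derivable
  (\<open>closes_imp_G3Ti\<close>). A rule that removes \<open>X\<close> from the block uses up one copy of \<open>X\<close> in the
  sequent, and copies that remain are covered by the inclusion.

  From sequents to tableaux one needs that a tableau rule may also be used without removing its
  principal formula (\<open>closes_keeping\<close>). This amounts to the invertibility of all rules except
  \<open>F\<rightarrow>\<close> (\<open>closes_invert\<close>), since inverting the rule removes the copy that was kept. The rule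
  \<open>F\<rightarrow>\<close> needs no such argument, because it discards every \<open>F\<close>-formula, copies of the
  principal formula included.

  These arguments run over a presentation of refutability that has only one clause for all the
  invertible rules. The statement about blocks follows from the one about sequents, as a finite
  block is the block of its own sequent.
\<close>

section \<open>Refutability as an inductive predicate\<close>

text \<open>
  The sets of signed formulae that replace the principal formula in the children, for the five
  rules that keep their whole context. In the left child of \<open>T\<rightarrow>\<close> the principal formula is
  displayed again, so it is listed among its own replacements.
\<close>

fun alternatives :: "'v sform \<Rightarrow> 'v block set" where
  "alternatives (T (A \<^bold>\<and> B)) = {{T A, T B}}"
| "alternatives (F (A \<^bold>\<or> B)) = {{F A, F B}}"
| "alternatives (T (A \<^bold>\<or> B)) = {{T A}, {T B}}"
| "alternatives (F (A \<^bold>\<and> B)) = {{F A}, {F B}}"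
| "alternatives (T (A \<^bold>\<rightarrow> B)) = {{T (A \<^bold>\<rightarrow> B), F A}, {T B}}"
| "alternatives _ = {}"

inductive closes :: "'v block \<Rightarrow> bool" where
  closed: "closed_block \<Pi> \<Longrightarrow> closes \<Pi>"
| local: "X \<in> \<Pi> \<Longrightarrow> alternatives X \<noteq> {} \<Longrightarrow>
    (\<And>C. C \<in> alternatives X \<Longrightarrow> closes (\<Pi> - {X} \<union> C)) \<Longrightarrow> closes \<Pi>"
| F_Imp: "F (A \<^bold>\<rightarrow> B) \<in> \<Pi> \<Longrightarrow> closes (T_part \<Pi> \<union> {T A, F B}) \<Longrightarrow> closes \<Pi>"

lemma T_part_mono: "\<Pi> \<subseteq> \<Pi>' \<Longrightarrow> T_part \<Pi> \<subseteq> T_part \<Pi>'"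
  by (auto simp: T_part_def)

lemma T_part_insert_F: "T_part (insert (F A) \<Pi>) = T_part \<Pi>"
  by (auto simp: T_part_def)

lemma bt_rule_local:
  assumes "X \<in> \<Pi>" "alternatives X \<noteq> {}"
  obtains \<Pi>s where "bt_rule \<Pi> \<Pi>s" "set \<Pi>s = (\<lambda>C. \<Pi> - {X} \<union> C) ` alternatives X"
proof -
  have "\<Pi> = insert X (\<Pi> - {X})" "X \<notin> \<Pi> - {X}" using assms(1) by auto
  then obtain \<Pi>0 where \<Pi>: "\<Pi> = insert X \<Pi>0" "X \<notin> \<Pi>0" by blast
  then have rest: "\<Pi> - {X} = \<Pi>0" by auto
  show thesis
  proof (cases X rule: alternatives.cases)
    case (1 A B)
    show thesis
      by (rule that, unfold \<Pi>(1) 1, rule bt_rule.T_And) (use \<Pi>(2) rest 1 in auto)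
  next
    case (2 A B)
    show thesis
      by (rule that, unfold \<Pi>(1) 2, rule bt_rule.F_Or) (use \<Pi>(2) rest 2 in auto)
  next
    case (3 A B)
    show thesis
      by (rule that, unfold \<Pi>(1) 3, rule bt_rule.T_Or) (use \<Pi>(2) rest 3 in auto)
  next
    case (4 A B)
    show thesis
      by (rule that, unfold \<Pi>(1) 4, rule bt_rule.F_And) (use \<Pi>(2) rest 4 in auto)
  next
    case (5 A B)
    show thesis
      by (rule that, unfold \<Pi>(1) 5, rule bt_rule.T_Imp) (use \<Pi>(2) rest 5 in auto)
  qed (use assms(2) in auto)
qed

lemma bt_rule_F_Imp:
  assumes "F (A \<^bold>\<rightarrow> B) \<in> \<Pi>"
  shows "bt_rule \<Pi> [T_part \<Pi> \<union> {T A, F B}]"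
  using bt_rule.F_Imp[of A B "\<Pi> - {F (A \<^bold>\<rightarrow> B)}"] assms
  by (metis T_part_insert_F Diff_iff insert_Diff singletonI)

text \<open>Hence an expanded node is not a leaf, and its leaves are those of its children.\<close>

lemma bt_rule_nonempty: "bt_rule \<Pi> \<Pi>s \<Longrightarrow> \<Pi>s \<noteq> []"
  by (induction rule: bt_rule.induct) auto

lemma closes_bt_rule:
  assumes "bt_rule \<Pi> \<Pi>s" "\<forall>\<Pi>' \<in> set \<Pi>s. closes \<Pi>'"
  shows "closes \<Pi>"
  using assms
proof (induction rule: bt_rule.induct)
  case (F_Imp A B \<Pi>)
  then show ?case
    by - (rule closes.F_Imp[of A B], auto simp: T_part_insert_F)
next
  case (T_And A B \<Pi>)
  then show ?case by - (rule closes.local[of "T (A \<^bold>\<and> B)"], auto)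
next
  case (F_Or A B \<Pi>)
  then show ?case by - (rule closes.local[of "F (A \<^bold>\<or> B)"], auto)
next
  case (T_Or A B \<Pi>)
  then show ?case by - (rule closes.local[of "T (A \<^bold>\<or> B)"], auto)
next
  case (F_And A B \<Pi>)
  then show ?case by - (rule closes.local[of "F (A \<^bold>\<and> B)"], auto)
next
  case (T_Imp A B \<Pi>)
  then show ?case by - (rule closes.local[of "T (A \<^bold>\<rightarrow> B)"], auto)
qed

lemma tableau_closes:
  "tableau t \<Longrightarrow> \<forall>\<Pi> \<in> leaves t. closed_block \<Pi> \<Longrightarrow> closes (root t)"
proof (induction rule: tableau.induct)
  case (leaf \<Pi>)
  then show ?case by (auto intro: closes.closed)
next
  case (expand \<Pi> ts)
  have "ts \<noteq> []" using bt_rule_nonempty[OF expand.hyps(1)] by simp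
  then have "closes (root t)" if "t \<in> set ts" for t
    using expand.IH(1)[OF that] expand.prems that by auto
  then have "closes \<Pi>" using closes_bt_rule[OF expand.hyps(1)] by auto
  then show ?case by simp
qed

lemma refutable_bt_rule:
  assumes rule: "bt_rule \<Pi> \<Pi>s" and "\<And>\<Pi>'. \<Pi>' \<in> set \<Pi>s \<Longrightarrow> refutable \<Pi>'"
  shows "refutable \<Pi>"
proof -
  obtain f where f: "\<And>\<Pi>'. \<Pi>' \<in> set \<Pi>s \<Longrightarrow>
      tableau (f \<Pi>') \<and> root (f \<Pi>') = \<Pi>' \<and> (\<forall>\<Pi>'' \<in> leaves (f \<Pi>'). closed_block \<Pi>'')"
    using assms(2) unfolding refutable_def by metis
  then have "map root (map f \<Pi>s) = \<Pi>s" by (auto simp: map_idI)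
  then have "tableau (Node \<Pi> (map f \<Pi>s))"
    using rule f by - (rule tableau.expand, auto)
  moreover have "\<forall>\<Pi>' \<in> leaves (Node \<Pi> (map f \<Pi>s)). closed_block \<Pi>'"
    using bt_rule_nonempty[OF rule] f by auto
  ultimately show ?thesis unfolding refutable_def by (metis btree.sel(1))
qed

lemma closes_refutable: "closes \<Pi> \<Longrightarrow> refutable \<Pi>"
proof (induction rule: closes.induct)
  case (closed \<Pi>)
  then have "tableau (Node \<Pi> []) \<and> (\<forall>\<Pi>' \<in> leaves (Node \<Pi> []). closed_block \<Pi>')"
    by (auto intro: tableau.leaf)
  then show ?case unfolding refutable_def by (metis btree.sel(1))
next
  case (local X \<Pi>)
  obtain \<Pi>s where "bt_rule \<Pi> \<Pi>s" "set \<Pi>s = (\<lambda>C. \<Pi> - {X} \<union> C) ` alternatives X"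
    using bt_rule_local local.hyps(1,2) by blast
  then show ?case using local.IH by - (rule refutable_bt_rule, auto)
next
  case (F_Imp A B \<Pi>)
  then show ?case
    using refutable_bt_rule[OF bt_rule_F_Imp] by (metis empty_iff empty_set set_ConsD)
qed

lemma refutable_iff_closes: "refutable \<Pi> \<longleftrightarrow> closes \<Pi>"
  using tableau_closes closes_refutable unfolding refutable_def by metis

section \<open>Weakening, inversion and contraction for tableaux\<close>

lemma closes_weaken: "closes \<Pi> \<Longrightarrow> \<Pi> \<subseteq> \<Pi>' \<Longrightarrow> closes \<Pi>'"
proof (induction arbitrary: \<Pi>' rule: closes.induct)
  case (closed \<Pi>)
  then have "closed_block \<Pi>'" unfolding closed_block_def by blast
  then show ?case by (rule closes.closed)
next
  case (local X \<Pi>)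
  show ?case
  proof (rule closes.local[of X])
    fix C assume "C \<in> alternatives X"
    then show "closes (\<Pi>' - {X} \<union> C)"
      by (rule local.IH) (use local.prems in auto)
  qed (use local in auto)
next
  case (F_Imp A B \<Pi>)
  have "closes (T_part \<Pi>' \<union> {T A, F B})"
    using T_part_mono[OF F_Imp.prems] by - (rule F_Imp.IH, auto)
  moreover have "F (A \<^bold>\<rightarrow> B) \<in> \<Pi>'" using F_Imp.hyps(1) F_Imp.prems by auto
  ultimately show ?case by (blast intro: closes.F_Imp)
qed

text \<open>
  Apart from the left child of \<open>T\<rightarrow>\<close>, replacements are simpler than what they replace, and the
  replacements of a \<open>T\<close>-formula are \<open>T\<close>-formulae, hence survive an application of \<open>F\<rightarrow>\<close>.
\<close>

lemma alternatives_smaller: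
  "C \<in> alternatives X \<Longrightarrow> X \<notin> C \<Longrightarrow> P \<in> C \<Longrightarrow> size P < size X"
  by (cases X rule: alternatives.cases) auto

lemma alternatives_T:
  "C \<in> alternatives (T A) \<Longrightarrow> T A \<notin> C \<Longrightarrow> T_part C = C"
  by (cases "T A" rule: alternatives.cases) (auto simp: T_part_def)

lemma closed_block_replace:
  "C \<in> alternatives X \<Longrightarrow> closed_block \<Pi> \<Longrightarrow> closed_block (\<Pi> - {X} \<union> C)"
  by (cases X rule: alternatives.cases) (auto simp: closed_block_def)

text \<open>
  Induction on the size of \<open>X\<close> and then on the closed tableau. The steps of the tableau are
  permuted with the replacement of \<open>X\<close>; a conflict arises only when the tableau expands some \<open>P\<close>
  that also occurs in \<open>C\<close>. Then the replacement puts \<open>P\<close> back after its expansion, and the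
  hypothesis on sizes, applied to \<open>P\<close>, eliminates it again. The left child of \<open>T\<rightarrow>\<close>, where
  sizes need not decrease, has \<open>X \<in> C\<close>; there inversion is just weakening.
\<close>

lemma closes_invert:
  assumes "closes \<Pi>" "C \<in> alternatives X"
  shows "closes (\<Pi> - {X} \<union> C)"
  using assms
proof (induction X arbitrary: \<Pi> C rule: measure_induct_rule[of size])
  case (less X)
  note smaller = less.IH and C = less.prems(2)
  show ?case
  proof (cases "X \<in> C")
    case True
    then show ?thesis by (intro closes_weaken[OF less.prems(1)]) auto
  next
    case X: False
    show ?thesis
      using less.prems(1)
    proof (induction rule: closes.induct)
      case (closed \<Pi>)
      then show ?case using closed_block_replace[OF C] by (blast intro: closes.closed)
    next
      case (local P \<Pi>)
      show ?case
      proof (cases "P = X")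
        case True
        then show ?thesis using local.hyps(3) C by blast
      next
        case False
        show ?thesis
        proof (rule closes.local[of P])
          fix D assume D: "D \<in> alternatives P"
          have IH: "closes ((\<Pi> - {P} \<union> D) - {X} \<union> C)" by (rule local.IH[OF D])
          show "closes ((\<Pi> - {X} \<union> C) - {P} \<union> D)"
          proof (cases "P \<in> C")
            case True
            then have "closes (((\<Pi> - {P} \<union> D) - {X} \<union> C) - {P} \<union> D)"
              by (rule smaller[OF alternatives_smaller[OF C X] IH D])
            then show ?thesis by (rule closes_weaken) auto
          next
            case False
            then show ?thesis by (intro closes_weaken[OF IH]) auto
          qed
        qed (use local.hyps False in auto)
      qed
    next
      case (F_Imp A B \<Pi>)
      have "closes (T_part (\<Pi> - {X} \<union> C) \<union> {T A, F B})"
      proof (cases X)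
        case (T E)
        then have "C = T_part C" using alternatives_T C X by metis
        then have "(T_part \<Pi> \<union> {T A, F B}) - {X} \<union> C \<subseteq> T_part (\<Pi> - {X} \<union> C) \<union> {T A, F B}"
          by (auto simp: T_part_def)
        then show ?thesis by (rule closes_weaken[OF F_Imp.IH])
      next
        \<comment> \<open>The step discards \<open>X\<close>, so its child is already what is needed.\<close>
        case (F E)
        then have "T_part \<Pi> \<union> {T A, F B} \<subseteq> T_part (\<Pi> - {X} \<union> C) \<union> {T A, F B}"
          by (auto simp: T_part_def)
        then show ?thesis by (rule closes_weaken[OF F_Imp.hyps(2)])
      qed
      moreover have "F (A \<^bold>\<rightarrow> B) \<in> \<Pi> - {X} \<union> C" using F_Imp.hyps(1) C by auto
      ultimately show ?case by (blast intro: closes.F_Imp)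
    qed
  qed
qed

text \<open>
  The tableau form of contraction: inverting the rule for \<open>X\<close> in each child eliminates the copy
  of \<open>X\<close> that was kept there.
\<close>

lemma closes_keeping:
  assumes "X \<in> \<Pi>" "alternatives X \<noteq> {}" "\<And>C. C \<in> alternatives X \<Longrightarrow> closes (\<Pi> \<union> C)"
  shows "closes \<Pi>"
proof (rule closes.local[of X])
  fix C assume C: "C \<in> alternatives X"
  have "closes (\<Pi> \<union> C - {X} \<union> C)" by (rule closes_invert[OF assms(3)[OF C] C])
  then show "closes (\<Pi> - {X} \<union> C)" by (rule closes_weaken) auto
qed (use assms in auto)

section \<open>Comparison with the sequent calculus\<close>

lemma T_in_block_of: "T A \<in> block_of \<Gamma> \<Delta> \<longleftrightarrow> A \<in># \<Gamma>"
  by (auto simp: block_of_def)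

lemma F_in_block_of: "F A \<in> block_of \<Gamma> \<Delta> \<longleftrightarrow> A \<in># \<Delta>"
  by (auto simp: block_of_def)

lemma block_of_add_ant: "block_of (add_mset A \<Gamma>) \<Delta> = insert (T A) (block_of \<Gamma> \<Delta>)"
  by (auto simp: block_of_def)

lemma block_of_add_suc: "block_of \<Gamma> (add_mset A \<Delta>) = insert (F A) (block_of \<Gamma> \<Delta>)"
  by (auto simp: block_of_def)

lemmas block_of_add = block_of_add_ant block_of_add_suc

lemma G3Ti_imp_closes: "\<Gamma> \<Rightarrow>\<^sub>G \<Delta> \<Longrightarrow> closes (block_of \<Gamma> \<Delta>)"
proof (induction rule: G3Ti.induct)
  case (Ax p \<Gamma> \<Delta>)
  then show ?case by (auto intro!: closes.closed simp: closed_block_def block_of_add)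
next
  case (BotL \<Gamma> \<Delta>)
  then show ?case by (auto intro!: closes.closed simp: closed_block_def block_of_add)
next
  case (AndL A B \<Gamma> \<Delta>)
  show ?case
    by (rule closes_keeping[of "T (A \<^bold>\<and> B)"])
      (auto simp: block_of_add intro: closes_weaken[OF AndL.IH])
next
  case (OrL A \<Gamma> \<Delta> B)
  show ?case
    by (rule closes_keeping[of "T (A \<^bold>\<or> B)"])
      (auto simp: block_of_add intro: closes_weaken[OF OrL.IH(1)] closes_weaken[OF OrL.IH(2)])
next
  case (ImpL A B \<Gamma> \<Delta>)
  show ?case
    by (rule closes_keeping[of "T (A \<^bold>\<rightarrow> B)"])
      (auto simp: block_of_add intro: closes_weaken[OF ImpL.IH(1)] closes_weaken[OF ImpL.IH(2)])
next
  case (AndR \<Gamma> A \<Delta> B)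
  show ?case
    by (rule closes_keeping[of "F (A \<^bold>\<and> B)"])
      (auto simp: block_of_add intro: closes_weaken[OF AndR.IH(1)] closes_weaken[OF AndR.IH(2)])
next
  case (OrR \<Gamma> A B \<Delta>)
  show ?case
    by (rule closes_keeping[of "F (A \<^bold>\<or> B)"])
      (auto simp: block_of_add intro: closes_weaken[OF OrR.IH])
next
  case (ImpR A \<Gamma> B \<Delta>)
  show ?case
  proof (rule closes.F_Imp[of A B])
    show "closes (T_part (block_of \<Gamma> (add_mset (A \<^bold>\<rightarrow> B) \<Delta>)) \<union> {T A, F B})"
      by (rule closes_weaken[OF ImpR.IH]) (auto simp: block_of_def T_part_def)
  qed (simp add: block_of_add)
qed

text \<open>
  The inclusion instead of an equation in the hypothesis is what makes the induction work: the
  sequent may contain several copies of a formula of \<open>\<Pi>\<close>, and formulae outside \<open>\<Pi>\<close>.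
\<close>

lemma closes_imp_G3Ti: "closes \<Pi> \<Longrightarrow> \<Pi> \<subseteq> block_of \<Gamma> \<Delta> \<Longrightarrow> \<Gamma> \<Rightarrow>\<^sub>G \<Delta>"
proof (induction arbitrary: \<Gamma> \<Delta> rule: closes.induct)
  case (closed \<Pi>)
  then consider p where "Var p \<in># \<Gamma>" "Var p \<in># \<Delta>" | "\<^bold>\<bottom> \<in># \<Gamma>"
    unfolding closed_block_def by (meson T_in_block_of F_in_block_of subsetD)
  then show ?case by cases (metis G3Ti.Ax G3Ti.BotL multi_member_split)+
next
  case (local X \<Pi>)
  \<comment> \<open>Removing \<open>X\<close> from \<open>\<Pi>\<close> pays for removing one copy of the principal formula.\<close>
  show ?case
  proof (cases X)
    case (T E)
    then have "E \<in># \<Gamma>" using local.hyps(1) local.prems by (auto simp: T_in_block_of)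
    then obtain \<Gamma>' where \<Gamma>: "\<Gamma> = add_mset E \<Gamma>'" by (metis multi_member_split)
    then have sub: "\<Pi> - {X} \<subseteq> block_of \<Gamma>' \<Delta>" using local.prems T by (auto simp: block_of_add)
    have IH: "\<Gamma>2 \<Rightarrow>\<^sub>G \<Delta>2"
      if "C \<in> alternatives X" "block_of \<Gamma>' \<Delta> \<union> C \<subseteq> block_of \<Gamma>2 \<Delta>2" for C \<Gamma>2 \<Delta>2
      using local.IH[OF that(1)] that(2) sub by blast
    show ?thesis
    proof (cases E)
      case (And A B)
      show ?thesis unfolding \<Gamma> And
        by (rule G3Ti.AndL[OF IH[of "{T A, T B}"]]) (auto simp: T And block_of_add)
    next
      case (Or A B)
      show ?thesis unfolding \<Gamma> Or
        by (rule G3Ti.OrL[OF IH[of "{T A}"] IH[of "{T B}"]]) (auto simp: T Or block_of_add)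
    next
      case (Imp A B)
      show ?thesis unfolding \<Gamma> Imp
        by (rule G3Ti.ImpL[OF IH[of "{T (A \<^bold>\<rightarrow> B), F A}"] IH[of "{T B}"]])
          (auto simp: T Imp block_of_add)
    qed (use local.hyps(2) T in auto)
  next
    case (F E)
    then have "E \<in># \<Delta>" using local.hyps(1) local.prems by (auto simp: F_in_block_of)
    then obtain \<Delta>' where \<Delta>: "\<Delta> = add_mset E \<Delta>'" by (metis multi_member_split)
    then have sub: "\<Pi> - {X} \<subseteq> block_of \<Gamma> \<Delta>'" using local.prems F by (auto simp: block_of_add)
    have IH: "\<Gamma>2 \<Rightarrow>\<^sub>G \<Delta>2"
      if "C \<in> alternatives X" "block_of \<Gamma> \<Delta>' \<union> C \<subseteq> block_of \<Gamma>2 \<Delta>2" for C \<Gamma>2 \<Delta>2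
      using local.IH[OF that(1)] that(2) sub by blast
    show ?thesis
    proof (cases E)
      case (And A B)
      show ?thesis unfolding \<Delta> And
        by (rule G3Ti.AndR[OF IH[of "{F A}"] IH[of "{F B}"]]) (auto simp: F And block_of_add)
    next
      case (Or A B)
      show ?thesis unfolding \<Delta> Or
        by (rule G3Ti.OrR[OF IH[of "{F A, F B}"]]) (auto simp: F Or block_of_add)
    qed (use local.hyps(2) F in auto)
  qed
next
  case (F_Imp A B \<Pi>)
  have "A \<^bold>\<rightarrow> B \<in># \<Delta>" using F_Imp.hyps(1) F_Imp.prems by (auto simp: F_in_block_of)
  then obtain \<Delta>' where \<Delta>: "\<Delta> = add_mset (A \<^bold>\<rightarrow> B) \<Delta>'" by (metis multi_member_split)
  have "T_part \<Pi> \<union> {T A, F B} \<subseteq> block_of (add_mset A \<Gamma>) {#B#}"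
    using F_Imp.prems by (auto simp: block_of_def T_part_def)
  then show ?case unfolding \<Delta> by (rule G3Ti.ImpR[OF F_Imp.IH])
qed

lemma block_of_ant_suc:
  assumes "finite \<Pi>"
  shows "block_of (ant \<Pi>) (suc \<Pi>) = \<Pi>"
proof -
  have "finite {A. T A \<in> \<Pi>}" "finite {A. F A \<in> \<Pi>}"
    using finite_vimageI[OF assms, of T] finite_vimageI[OF assms, of F]
    by (auto simp: vimage_def inj_def)
  moreover have "T ` {A. T A \<in> \<Pi>} \<union> F ` {A. F A \<in> \<Pi>} = \<Pi>"
  proof
    show "\<Pi> \<subseteq> T ` {A. T A \<in> \<Pi>} \<union> F ` {A. F A \<in> \<Pi>}"
    proof
      fix X assume "X \<in> \<Pi>"
      then show "X \<in> T ` {A. T A \<in> \<Pi>} \<union> F ` {A. F A \<in> \<Pi>}" by (cases X) auto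
    qed
  qed auto
  ultimately show ?thesis by (simp add: block_of_def ant_def suc_def)
qed

theorem theorem4p9:
  "(\<forall>\<Pi> :: ('v :: countable) block. finite \<Pi> \<longrightarrow> (refutable \<Pi> \<longleftrightarrow> ant \<Pi> \<Rightarrow>\<^sub>G suc \<Pi>)) \<and>
   (\<forall>(\<Gamma> :: 'v form multiset) \<Delta>. \<Gamma> \<Rightarrow>\<^sub>G \<Delta> \<longleftrightarrow> refutable (block_of \<Gamma> \<Delta>))"
proof -
  have sequents: "\<Gamma> \<Rightarrow>\<^sub>G \<Delta> \<longleftrightarrow> refutable (block_of \<Gamma> \<Delta>)" for \<Gamma> \<Delta> :: "'v form multiset"
    using G3Ti_imp_closes closes_imp_G3Ti refutable_iff_closes by blast
  then show ?thesis by (simp add: block_of_ant_suc)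
qed

end
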